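(* Let $T>0$ and let $X_t$ be a Responsive Fractional Brownian Motion on a complete probability space $(\Omega,\mathcal{F},\mathbb{P})$, whose state-dependent Hurst response function $H:[0,T]\times\mathbb{R}\to(0,1)$ is a Lipschitz-Hölder response function with the following additional regularity: (i) for each fixed $s\in[0,T]$, the function $H(s,\cdot):\mathbb{R}\to[h_{\min},h_{\max}]$ is continuously differentiable; (ii) there is a constant $L_{\partial H}>0$ with $\sup_{(s,x)\in[0,T]\times\mathbb{R}}\left|\frac{\partial H}{\partial x}(s,x)\right|\le L_{\partial H}$; (iii) $h_{\min}>0$, ensuring the uniform boundedness of $1/H(s,x)$ over the domain. Consider a version of $X$ with continuous sample paths. Let $K(t,s;x)=\sqrt{2H(s,x)}\,(t-s)^{H(s,x)-1/2}$ be the memory kernel. Then there exists a set $\Omega_0\subset\Omega$ with $\mathbb{P}(\Omega_0)=1$ such that for every $\omega\in\Omega_0$ the sample path $s\mapsto X_s(\omega)$ is continuous on $[0,T]$, and for any fixed $t\in(0,T]$ and any $s\in[0,t)$ the following hold. 1. (Sensitivity structure) The pathwise logarithmic sensitivity function $\mathcal{S}(s,\omega)$ of the memory kernel $K(t,s;\cdot)$ with respect to its state variable at $x=X_s(\omega)$, that is, $\frac{\partial}{\partial x}\ln K(t,s;x)\big|_{x=X_s(\omega)}$, exists and is given by $$\mathcal{S}(s,\omega)=\frac{\partial H}{\partial x}(s,X_s(\omega))\left[\frac{1}{2H(s,X_s(\omega))}+\ln(t-s)\right].$$ 2. (Relative sensitivity principle) For any $0\le s_1<s_2<t$, define the pathwise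 relative sensitivity function $\mathcal{E}(s_1,s_2,t;\omega)=\mathcal{S}(s_1,\omega)-\mathcal{S}(s_2,\omega)$. It admits the explicit representation $$\mathcal{E}(s_1,s_2,t;\omega)=\frac{\partial H}{\partial x}(s_1,X_{s_1}(\omega))\left[\frac{1}{2H(s_1,X_{s_1}(\omega))}+\ln(t-s_1)\right]-\frac{\partial H}{\partial x}(s_2,X_{s_2}(\omega))\left[\frac{1}{2H(s_2,X_{s_2}(\omega))}+\ln(t-s_2)\right].$$ The sign of $\mathcal{E}(s_1,s_2,t;\omega)$ provides a comparative measure of how the memory allocation (governed by the kernel $K$) at the current time $t$ would respond to infinitesimal changes in the historical states. Specifically, for the realized path $\omega$: - if $\mathcal{E}(s_1,s_2,t;\omega)>0$, a perturbation of the state at time $s_1$ would induce a larger relative change in the memory weight $K(t,s_1;X_{s_1})$ compared to a similar perturbation at time $s_2$; - conversely, if $\mathcal{E}(s_1,s_2,t;\omega)<0$, the memory weight is more sensitive to perturbations at the later time $s_2$.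
   Context: Lipschitz-Hölder response function: a function $H:[0,T]\times\mathbb{R}\to(0,1)$ for which there are constants $L_H>0$, $C_H>0$, $\gamma\in(0,1]$ and $0<h_{\min}\le h_{\max}<1$ such that, for all $t,s\in[0,T]$ and $x,y\in\mathbb{R}$: $|H(t,x)-H(t,y)|\le L_H|x-y|$; $|H(t,x)-H(s,x)|\le C_H|t-s|^\gamma$; $h_{\min}\le H(t,x)\le h_{\max}$. Responsive Fractional Brownian Motion (RfBm) with response function $H$: on a filtered probability space satisfying the usual conditions and supporting a standard Brownian motion $B$ for the filtration, an adapted process $\{X_t\}_{t\in[0,T]}$ with almost surely continuous sample paths such that, for each $t\in[0,T]$, the Itô integral below is well-defined and, $\mathbb{P}$-almost surely, $$X_t=\int_0^t\sqrt{2H(s,X_s)}\,(t-s)^{H(s,X_s)-1/2}\,dB(s).$$ *)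

theory Defs
  imports "HOL-Probability.Probability"
begin

text \<open>Filtrations are indexed by all reals, as required by \<^locale>\<open>filtration\<close> at this type;
  only the times in \<^term>\<open>{0..T}\<close> matter (a filtration on \<open>[0,T]\<close> extends constantly).
  As the underlying space is complete, \<^term>\<open>null_sets M\<close> contains all negligible sets.\<close>

locale usual_filtered_prob_space =
  prob_space M + complete_measure M + filtration "space M" F
  for T :: real and M :: "'a measure" and F :: "real \<Rightarrow> 'a measure" +
  assumes subalgebra_F: "subalgebra M (F t)"
    and null_sets_F: "null_sets M \<subseteq> sets (F 0)"
    and right_continuous_F: "t \<in> {0..<T} \<Longrightarrow> sets (F t) = (\<Inter>u\<in>{t<..T}. sets (F u))"

definition adapted_on ::
    "real \<Rightarrow> (real \<Rightarrow> 'a measure) \<Rightarrow> (real \<Rightarrow> 'a \<Rightarrow> real) \<Rightarrow> bool" where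
  "adapted_on T F X \<longleftrightarrow> (\<forall>t\<in>{0..T}. X t \<in> borel_measurable (F t))"

definition brownian_motion_on ::
    "real \<Rightarrow> 'a measure \<Rightarrow> (real \<Rightarrow> 'a measure) \<Rightarrow> (real \<Rightarrow> 'a \<Rightarrow> real) \<Rightarrow> bool" where
  "brownian_motion_on T M F B \<longleftrightarrow>
     adapted_on T F B \<and>
     (AE \<omega> in M. B 0 \<omega> = 0) \<and>
     (AE \<omega> in M. continuous_on {0..T} (\<lambda>t. B t \<omega>)) \<and>
     (\<forall>s t. 0 \<le> s \<and> s < t \<and> t \<le> T \<longrightarrow>
        distributed M lborel (\<lambda>\<omega>. B t \<omega> - B s \<omega>) (normal_density 0 (sqrt (t - s))) \<and>
        prob_space.indep_set M (sets (F s))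
          {(\<lambda>\<omega>. B t \<omega> - B s \<omega>) -` A \<inter> space M | A. A \<in> sets borel})"

definition version_on ::
    "real \<Rightarrow> 'a measure \<Rightarrow> (real \<Rightarrow> 'a \<Rightarrow> real) \<Rightarrow> (real \<Rightarrow> 'a \<Rightarrow> real) \<Rightarrow> bool" where
  "version_on T M Y X \<longleftrightarrow> (\<forall>t\<in>{0..T}. AE \<omega> in M. Y t \<omega> = X t \<omega>)"

text \<open>A triple \<open>(n, \<tau>, \<xi>)\<close> encodes the step process
  \<open>\<Sum>i<n. \<xi> i \<cdot> 1_(\<tau> i, \<tau> (i + 1)]\<close> on \<open>[0,t]\<close>.\<close>

type_synonym 'a step = "nat \<times> (nat \<Rightarrow> real) \<times> (nat \<Rightarrow> 'a \<Rightarrow> real)"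

definition step_on :: "(real \<Rightarrow> 'a measure) \<Rightarrow> real \<Rightarrow> 'a step \<Rightarrow> bool" where
  "step_on F t = (\<lambda>(n, \<tau>, \<xi>).
     (\<forall>i<n. 0 \<le> \<tau> i \<and> \<tau> i \<le> \<tau> (Suc i) \<and> \<tau> (Suc i) \<le> t \<and>
        \<xi> i \<in> borel_measurable (F (\<tau> i)) \<and> bounded (\<xi> i ` space (F (\<tau> i)))))"

definition step_process :: "'a step \<Rightarrow> real \<Rightarrow> 'a \<Rightarrow> real" where
  "step_process = (\<lambda>(n, \<tau>, \<xi>) s \<omega>. \<Sum>i<n. \<xi> i \<omega> * indicator {\<tau> i<..\<tau> (Suc i)} s)"

definition step_integral :: "(real \<Rightarrow> 'a \<Rightarrow> real) \<Rightarrow> 'a step \<Rightarrow> 'a \<Rightarrow> real" where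
  "step_integral B = (\<lambda>(n, \<tau>, \<xi>) \<omega>. \<Sum>i<n. \<xi> i \<omega> * (B (\<tau> (Suc i)) \<omega> - B (\<tau> i) \<omega>))"

definition progressive_on ::
    "(real \<Rightarrow> 'a measure) \<Rightarrow> real \<Rightarrow> (real \<Rightarrow> 'a \<Rightarrow> real) \<Rightarrow> bool" where
  "progressive_on F t g \<longleftrightarrow>
     (\<forall>u\<in>{0..t}. (\<lambda>(s, \<omega>). g s \<omega>) \<in> borel_measurable (restrict_space borel {0..u} \<Otimes>\<^sub>M F u))"

definition L2_norm_sq :: "'a measure \<Rightarrow> real \<Rightarrow> (real \<Rightarrow> 'a \<Rightarrow> real) \<Rightarrow> ennreal" where
  "L2_norm_sq M t g = (\<integral>\<^sup>+\<omega>. (\<integral>\<^sup>+s\<in>{0..t}. ennreal ((g s \<omega>)\<^sup>2) \<partial>lborel) \<partial>M)"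

text \<open>\<open>I\<close> is (a representative of) \<open>\<integral>\<^sub>0\<^sup>t f dB\<close>: the integrand \<open>f\<close> is indistinguishable on
  \<open>[0,t)\<close> from a progressively measurable \<open>g \<in> L\<^sup>2([0,t] \<times> \<Omega>)\<close>, and \<open>I\<close> is the \<open>L\<^sup>2\<close>-limit of the
  integrals of step processes converging to \<open>g\<close> in \<open>L\<^sup>2([0,t] \<times> \<Omega>)\<close>.  Passing from \<open>f\<close> to \<open>g\<close>
  admits integrands built from processes whose paths are continuous only almost surely, and
  makes the value at the singular endpoint of the kernels below irrelevant.\<close>

definition has_ito_integral ::
    "'a measure \<Rightarrow> (real \<Rightarrow> 'a measure) \<Rightarrow> (real \<Rightarrow> 'a \<Rightarrow> real) \<Rightarrow> real \<Rightarrow>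
      (real \<Rightarrow> 'a \<Rightarrow> real) \<Rightarrow> ('a \<Rightarrow> real) \<Rightarrow> bool" where
  "has_ito_integral M F B t f I \<longleftrightarrow>
     I \<in> borel_measurable M \<and>
     (\<exists>g. progressive_on F t g \<and> L2_norm_sq M t g < \<infinity> \<and>
          (AE \<omega> in M. \<forall>s\<in>{0..<t}. f s \<omega> = g s \<omega>) \<and>
          (\<exists>\<phi>. (\<forall>k. step_on F t (\<phi> k)) \<and>
               (\<lambda>k. L2_norm_sq M t (\<lambda>s \<omega>. step_process (\<phi> k) s \<omega> - g s \<omega>)) \<longlonglongrightarrow> 0 \<and>
               (\<lambda>k. \<integral>\<^sup>+\<omega>. ennreal ((step_integral B (\<phi> k) \<omega> - I \<omega>)\<^sup>2) \<partial>M) \<longlonglongrightarrow> 0))"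

definition lipschitz_hoelder_response ::
    "real \<Rightarrow> (real \<Rightarrow> real \<Rightarrow> real) \<Rightarrow> real \<Rightarrow> real \<Rightarrow> real \<Rightarrow> real \<Rightarrow> real \<Rightarrow> bool" where
  "lipschitz_hoelder_response T H L C \<gamma> h_min h_max \<longleftrightarrow>
     L > 0 \<and> C > 0 \<and> 0 < \<gamma> \<and> \<gamma> \<le> 1 \<and> 0 < h_min \<and> h_min \<le> h_max \<and> h_max < 1 \<and>
     (\<forall>t\<in>{0..T}. \<forall>s\<in>{0..T}. \<forall>x y.
        \<bar>H t x - H t y\<bar> \<le> L * \<bar>x - y\<bar> \<and>
        \<bar>H t x - H s x\<bar> \<le> C * \<bar>t - s\<bar> powr \<gamma> \<and>
        h_min \<le> H t x \<and> H t x \<le> h_max)"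

definition memory_kernel :: "(real \<Rightarrow> real \<Rightarrow> real) \<Rightarrow> real \<Rightarrow> real \<Rightarrow> real \<Rightarrow> real" where
  "memory_kernel H t s x = sqrt (2 * H s x) * (t - s) powr (H s x - 1 / 2)"

definition rfbm ::
    "real \<Rightarrow> 'a measure \<Rightarrow> (real \<Rightarrow> 'a measure) \<Rightarrow> (real \<Rightarrow> 'a \<Rightarrow> real) \<Rightarrow>
      (real \<Rightarrow> real \<Rightarrow> real) \<Rightarrow> (real \<Rightarrow> 'a \<Rightarrow> real) \<Rightarrow> bool" where
  "rfbm T M F B H X \<longleftrightarrow>
     usual_filtered_prob_space T M F \<and>
     brownian_motion_on T M F B \<and>
     adapted_on T F X \<and>
     (AE \<omega> in M. continuous_on {0..T} (\<lambda>t. X t \<omega>)) \<and>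
     (\<forall>t\<in>{0..T}. \<exists>I. has_ito_integral M F B t (\<lambda>s \<omega>. memory_kernel H t s (X s \<omega>)) I \<and>
                      (AE \<omega> in M. X t \<omega> = I \<omega>))"

definition log_sensitivity ::
    "(real \<Rightarrow> real \<Rightarrow> real) \<Rightarrow> (real \<Rightarrow> 'a \<Rightarrow> real) \<Rightarrow> real \<Rightarrow> real \<Rightarrow> 'a \<Rightarrow> real" where
  "log_sensitivity H X t s \<omega> = deriv (\<lambda>x. ln (memory_kernel H t s x)) (X s \<omega>)"

definition relative_sensitivity ::
    "(real \<Rightarrow> real \<Rightarrow> real) \<Rightarrow> (real \<Rightarrow> 'a \<Rightarrow> real) \<Rightarrow> real \<Rightarrow> real \<Rightarrow> real \<Rightarrow> 'a \<Rightarrow> real" where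
  "relative_sensitivity H X s1 s2 t \<omega> = log_sensitivity H X t s1 \<omega> - log_sensitivity H X t s2 \<omega>"

text \<open>The signed relative change of the memory weight at time \<open>s\<close>, per unit of perturbation, when
  the state \<open>x\<close> is perturbed to \<open>x + \<delta>\<close>.  For equal \<open>\<delta> > 0\<close>, comparing these
  quantities amounts to comparing the relative changes themselves.\<close>

definition relative_change_rate ::
    "(real \<Rightarrow> real \<Rightarrow> real) \<Rightarrow> real \<Rightarrow> real \<Rightarrow> real \<Rightarrow> real \<Rightarrow> real" where
  "relative_change_rate H t s x \<delta> =
     (memory_kernel H t s (x + \<delta>) - memory_kernel H t s x) / memory_kernel H t s x / \<delta>"

end

theory Submission
  imports Defs
begin

text \<open>For \<open>s < t\<close> the kernel is positive and its logarithm is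
  \<open>ln (2 H) / 2 + (H - 1/2) ln (t - s)\<close> with \<open>H = H(s, x)\<close>, so its logarithmic derivative in \<open>x\<close>
  is \<open>H' (1 / (2 H) + ln (t - s))\<close>: this is the sensitivity formula, and the formula for
  \<open>\<E>\<close> is a difference of two instances of it.  The sign of \<open>\<E>\<close> has the claimed meaning
  because the relative change of the kernel per unit of perturbation is a difference quotient,
  divided by the value of the kernel, and thus tends to the logarithmic derivative
  (lemma \<open>relative_change_rate_tendsto\<close>); a strict inequality between two limits passes to all
  small perturbations.

  The argument is deterministic in the value of the path and covers all times at once, so no null
  sets indexed by \<open>s\<close> or \<open>t\<close> accumulate: \<open>\<Omega>\<^sub>0\<close> is any measurable set of full probability on
  which the chosen version has continuous paths.\<close>

lemma memory_kernel_pos: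
  assumes "s < t" and "H s x > 0"
  shows "memory_kernel H t s x > 0"
  using assms by (simp add: memory_kernel_def)

text \<open>Each factor of the kernel is positive, so the derivative can be written as the kernel
  times its logarithmic derivative.  In this form, dividing by the kernel yields both the
  derivative of its logarithm and the limit of its relative difference quotients.\<close>

lemma memory_kernel_has_real_derivative:
  assumes "s < t" and "H s x > 0" and H': "(H s has_real_derivative D) (at x)"
  shows "(memory_kernel H t s has_real_derivative
    memory_kernel H t s x * (D * (1 / (2 * H s x) + ln (t - s)))) (at x)"
proof -
  have kernel: "memory_kernel H t s = (\<lambda>x. sqrt (2 * H s x) * (t - s) powr (H s x - 1 / 2))"
    by (simp add: memory_kernel_def fun_eq_iff)
  \<comment> \<open>The derivative \<open>D / sqrt (2 H)\<close> of the first factor is written as that factor times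
    \<open>D / (2 H)\<close>, so that the whole kernel can be factored out.\<close>
  have "((\<lambda>x. sqrt (2 * H s x)) has_real_derivative sqrt (2 * H s x) * (D / (2 * H s x))) (at x)"
  proof -
    have "((\<lambda>x. sqrt (2 * H s x)) has_real_derivative
        inverse (sqrt (2 * H s x)) / 2 * (2 * D)) (at x)"
      using assms by (auto intro!: derivative_eq_intros)
    moreover have "inverse (sqrt (2 * H s x)) / 2 * (2 * D) = sqrt (2 * H s x) * (D / (2 * H s x))"
      using \<open>H s x > 0\<close> real_sqrt_mult_self[of "2 * H s x"]
      by (simp add: field_simps del: real_sqrt_mult_self)
    ultimately show ?thesis by simp
  qed
  moreover have "((\<lambda>x. (t - s) powr (H s x - 1 / 2)) has_real_derivative
      (t - s) powr (H s x - 1 / 2) * (D * ln (t - s))) (at x)"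
  proof -
    have "((\<lambda>x. exp ((H s x - 1 / 2) * ln (t - s))) has_real_derivative
        exp ((H s x - 1 / 2) * ln (t - s)) * (D * ln (t - s))) (at x)"
      by (rule derivative_eq_intros H' refl)+ simp
    with \<open>s < t\<close> show ?thesis by (simp add: powr_def)
  qed
  ultimately show ?thesis
    unfolding kernel by (rule DERIV_cong[OF DERIV_mult]) (simp add: algebra_simps)
qed

lemma ln_memory_kernel_has_real_derivative:
  assumes "s < t" and "H s x > 0" and "(H s has_real_derivative D) (at x)"
  shows "((\<lambda>x. ln (memory_kernel H t s x)) has_real_derivative
    D * (1 / (2 * H s x) + ln (t - s))) (at x)"
  using DERIV_chain2[OF DERIV_ln_divide[OF memory_kernel_pos[of s t H x]]
    memory_kernel_has_real_derivative[of s t H x D, OF assms]]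
    memory_kernel_pos[of s t H x] assms(1,2)
  by simp

text \<open>This identifies the logarithmic sensitivity as the infinitesimal relative response of the memory
  weight: dividing the difference quotient of the kernel by its value at \<open>x\<close> cancels the factor
  \<open>K\<close> in \<open>K'\<close>.\<close>

lemma relative_change_rate_tendsto:
  assumes "s < t" and "H s x > 0" and "(H s has_real_derivative D) (at x)"
  shows "((relative_change_rate H t s x) \<longlongrightarrow> D * (1 / (2 * H s x) + ln (t - s))) (at 0)"
proof -
  have pos: "memory_kernel H t s x > 0"
    using assms(1,2) by (rule memory_kernel_pos)
  have "((\<lambda>\<delta>. (memory_kernel H t s (x + \<delta>) - memory_kernel H t s x) / \<delta> / memory_kernel H t s x)
      \<longlongrightarrow> memory_kernel H t s x * (D * (1 / (2 * H s x) + ln (t - s))) / memory_kernel H t s x) (at 0)"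
    using memory_kernel_has_real_derivative[of s t H x D, OF assms] pos
    by (intro tendsto_divide tendsto_const) (auto simp: DERIV_def)
  moreover have "relative_change_rate H t s x =
      (\<lambda>\<delta>. (memory_kernel H t s (x + \<delta>) - memory_kernel H t s x) / \<delta> / memory_kernel H t s x)"
    by (simp add: relative_change_rate_def fun_eq_iff mult.commute)
  ultimately show ?thesis using pos by simp
qed

lemma eventually_less_if_tendsto_less:
  fixes f g :: "'b \<Rightarrow> real"
  assumes "(f \<longlongrightarrow> a) G" and "(g \<longlongrightarrow> b) G" and "a < b"
  shows "\<forall>\<^sub>F x in G. f x < g x"
  using order_tendstoD(1)[OF tendsto_diff[OF assms(2,1)], of 0] assms(3) by simp

theorem theorem6p4:
  fixes T L_H C_H \<gamma> h_min h_max L_dH :: real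
    and M :: "'a measure" and F :: "real \<Rightarrow> 'a measure"
    and B X Y :: "real \<Rightarrow> 'a \<Rightarrow> real"
    and H :: "real \<Rightarrow> real \<Rightarrow> real"
  assumes "T > 0"
    and "lipschitz_hoelder_response T H L_H C_H \<gamma> h_min h_max"
    and "rfbm T M F B H X"
    and "\<forall>s\<in>{0..T}. H s C1_differentiable_on UNIV"
    and "L_dH > 0" and "\<forall>s\<in>{0..T}. \<forall>x. \<bar>deriv (H s) x\<bar> \<le> L_dH"
    and "h_min > 0"
    and "version_on T M Y X" and "AE \<omega> in M. continuous_on {0..T} (\<lambda>s. Y s \<omega>)"
  shows "\<exists>\<Omega>\<^sub>0\<in>sets M. measure M \<Omega>\<^sub>0 = 1 \<and>
    (\<forall>\<omega>\<in>\<Omega>\<^sub>0. continuous_on {0..T} (\<lambda>s. Y s \<omega>) \<and>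
      (\<forall>t\<in>{0<..T}.
        (\<forall>s\<in>{0..<t}.
          (\<lambda>x. ln (memory_kernel H t s x)) field_differentiable at (Y s \<omega>) \<and>
          log_sensitivity H Y t s \<omega> =
            deriv (H s) (Y s \<omega>) * (1 / (2 * H s (Y s \<omega>)) + ln (t - s))) \<and>
        (\<forall>s1 s2. 0 \<le> s1 \<and> s1 < s2 \<and> s2 < t \<longrightarrow>
          relative_sensitivity H Y s1 s2 t \<omega> =
            deriv (H s1) (Y s1 \<omega>) * (1 / (2 * H s1 (Y s1 \<omega>)) + ln (t - s1)) -
            deriv (H s2) (Y s2 \<omega>) * (1 / (2 * H s2 (Y s2 \<omega>)) + ln (t - s2)) \<and>
          (relative_sensitivity H Y s1 s2 t \<omega> > 0 \<longrightarrow>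
            (\<forall>\<^sub>F \<delta> in at 0.
              relative_change_rate H t s1 (Y s1 \<omega>) \<delta> > relative_change_rate H t s2 (Y s2 \<omega>) \<delta>)) \<and>
          (relative_sensitivity H Y s1 s2 t \<omega> < 0 \<longrightarrow>
            (\<forall>\<^sub>F \<delta> in at 0.
              relative_change_rate H t s1 (Y s1 \<omega>) \<delta> < relative_change_rate H t s2 (Y s2 \<omega>) \<delta>)))))"
proof -
  have "usual_filtered_prob_space T M F"
    using assms(3) by (simp add: rfbm_def)
  then interpret prob_space M
    by (rule usual_filtered_prob_space.axioms(1))
  obtain \<Omega>\<^sub>0 where \<Omega>\<^sub>0: "\<Omega>\<^sub>0 \<in> sets M" "measure M \<Omega>\<^sub>0 = 1"
    and cont: "\<And>\<omega>. \<omega> \<in> \<Omega>\<^sub>0 \<Longrightarrow> continuous_on {0..T} (\<lambda>s. Y s \<omega>)"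
    by (rule AE_E_prob[OF assms(9)]) (auto simp: subset_iff)

  have H_pos: "H s x > 0" if "s \<in> {0..T}" for s x
  proof -
    have "h_min \<le> H s x"
      using assms(2) that by (auto simp: lipschitz_hoelder_response_def)
    then show ?thesis using assms(7) by simp
  qed
  have H_deriv: "(H s has_real_derivative deriv (H s) x) (at x)" if "s \<in> {0..T}" for s x
    using assms(4) that
    by (auto simp: C1_differentiable_on_eq DERIV_deriv_iff_real_differentiable)

  define S where "S = (\<lambda>t s x. deriv (H s) x * (1 / (2 * H s x) + ln (t - s)))"
  have ln_deriv: "((\<lambda>x. ln (memory_kernel H t s x)) has_real_derivative S t s x) (at x)"
    and rate: "((relative_change_rate H t s x) \<longlongrightarrow> S t s x) (at 0)"
    if "t \<le> T" "0 \<le> s" "s < t" for t s x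
    unfolding S_def using that H_pos[of s x] H_deriv[of s x]
      ln_memory_kernel_has_real_derivative[of s t H x "deriv (H s) x"]
      relative_change_rate_tendsto[of s t H x "deriv (H s) x"]
    by simp_all
  have sens: "log_sensitivity H Y t s \<omega> = S t s (Y s \<omega>)"
    if "t \<le> T" "0 \<le> s" "s < t" for t s \<omega>
    unfolding log_sensitivity_def using ln_deriv[OF that] by (rule DERIV_imp_deriv)
  have rel: "relative_sensitivity H Y s1 s2 t \<omega> = S t s1 (Y s1 \<omega>) - S t s2 (Y s2 \<omega>)"
    if "t \<le> T" "0 \<le> s1" "s1 < s2" "s2 < t" for t s1 s2 \<omega>
    using that by (simp add: relative_sensitivity_def sens)
  have less: "\<forall>\<^sub>F \<delta> in at 0. relative_change_rate H t s x \<delta> < relative_change_rate H t s' x' \<delta>"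
    if "t \<le> T" "0 \<le> s" "s < t" "0 \<le> s'" "s' < t" "S t s x < S t s' x'" for t s s' x x'
    using that by (intro eventually_less_if_tendsto_less[OF rate rate])

  show ?thesis
  proof (intro bexI[of _ \<Omega>\<^sub>0] conjI ballI allI impI, goal_cases)
    case (3 \<omega> t s)
    then show ?case using ln_deriv[of t s] by (auto simp: field_differentiable_def)
  next
    case (4 \<omega> t s)
    then show ?case using sens[of t s \<omega>] by (simp add: S_def)
  next
    case (5 \<omega> t s1 s2)
    then show ?case using rel[of t s1 s2 \<omega>] by (simp add: S_def)
  next
    case (6 \<omega> t s1 s2)
    then show ?case using rel[of t s1 s2 \<omega>] by (intro less) auto
  next
    case (7 \<omega> t s1 s2)
    then show ?case using rel[of t s1 s2 \<omega>] by (intro less) auto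
  qed (use \<Omega>\<^sub>0 cont in auto)
qed

end
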